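(* Suppose $\nu=\nu_Z\in M_{\chi_\alpha,\sigma}(E)$ for an $E$-valued random element $Z$. Then the following are equivalent: (i) $\nu$ is $B$-invariant. (ii) For every $a\in\mathsf T$, $\nu_{B^aZ}=\nu_Z$; equivalently, every random element $B^aZ$ is another stochastic representer of $\nu$. (iii) For every $a\in\mathsf T$ and every $\Gamma\in\mathcal H_\alpha(E)$, $\mathbb E\{\Gamma(B^aZ)\}=\mathbb E\{\Gamma(Z)\}$.
   Context: Let $q\ge1$ be an integer, $(E,\mathcal E)$ an arbitrary measurable space, and $G=(0,\infty)^q$ with coordinatewise multiplication and its Borel $\sigma$-field. Let $S:G\times E\to E$, $(r,x)\mapsto S_rx$, be a jointly measurable left action: $S_{\boldsymbol 1}x=x$ with $\boldsymbol 1=(1,\ldots,1)$, and $S_r(S_sx)=S_{rs}x$. Fix $\alpha\in(0,\infty)^q$ and put $\chi_\alpha(r)=\prod_{i=1}^q r_i^{\alpha_i}$ and $\vartheta_\alpha(dr)=\prod_{i=1}^q\alpha_i r_i^{-\alpha_i-1}\,dr_i$ (a measure on $G$). A measure $\nu$ on $(E,\mathcal E)$ is $\chi_\alpha$-homogeneous if $\nu(S_rA)=\chi_\alpha(r)^{-1}\nu(A)$ for all $r\in G$, $A\in\mathcal E$. $M_{\chi_\alpha,\sigma}(E)$ is the set of nonzero $\sigma$-finite $\chi_\alpha$-homogeneous measures. For an $E$-valued random element $Z$, $\nu_Z(A)=\mathbb E\left\{\int_G\mathbb I_A(S_rZ)\,\vartheta_\alpha(dr)\right\}$, $A\in\mathcal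 E$; $Z$ is a stochastic representer of $\nu$ if $\nu=\nu_Z$. $\mathcal H_\alpha(E)$ is the set of all measurable $\Gamma:E\to[0,\infty]$ such that $\Gamma(S_rx)=\chi_\alpha(r)\Gamma(x)$ for all $r\in G$, $x\in E$. Equalities of expectations are in $[0,\infty]$. $\mathsf T$ is a locally compact second-countable Hausdorff group, and $B:\mathsf T\times E\to E$, $(a,x)\mapsto B^ax$, is a jointly measurable (left) action with $B^aS_rx=S_rB^ax$ for all $a\in\mathsf T$, $r\in G$, $x\in E$. A measure $\nu$ is $B$-invariant if $(B^a)_\#\nu=\nu$ for every $a\in\mathsf T$, where $(T_\#\nu)(A)=\nu(T^{-1}A)$. *)

theory Defs
  imports "HOL-Probability.Probability"
begin

text \<open>
  The group \<open>G = (0,\<infinity>)\<^sup>q\<close>: its multiplication and unit are the coordinatewise \<open>(*)\<close> and \<open>1\<close> of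
  the type \<open>real ^ 'q\<close>, so that \<open>q = CARD('q) \<ge> 1\<close>.
\<close>

definition pos_orthant :: "(real ^ 'q) set" where
  "pos_orthant = {r. \<forall>i. 0 < r $ i}"

text \<open>
  A measure \<open>E\<close> stands for the measurable space \<open>(space E, sets E)\<close>; its values are irrelevant.
  The acting group is the carrier \<open>space G\<close> of a measurable space \<open>G\<close>, with the given
  multiplication and unit.
\<close>

definition measurable_action ::
  "'g measure \<Rightarrow> ('g \<Rightarrow> 'g \<Rightarrow> 'g) \<Rightarrow> 'g \<Rightarrow> 'e measure \<Rightarrow> ('g \<Rightarrow> 'e \<Rightarrow> 'e) \<Rightarrow> bool" where
  "measurable_action G mul e E S \<longleftrightarrow>
     (\<lambda>(g, x). S g x) \<in> measurable (G \<Otimes>\<^sub>M E) E \<and>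
     (\<forall>x\<in>space E. S e x = x) \<and>
     (\<forall>g\<in>space G. \<forall>h\<in>space G. \<forall>x\<in>space E. S g (S h x) = S (mul g h) x)"

definition scaling_action :: "'e measure \<Rightarrow> (real ^ 'q \<Rightarrow> 'e \<Rightarrow> 'e) \<Rightarrow> bool" where
  "scaling_action E S \<longleftrightarrow> measurable_action (restrict_space borel pos_orthant) (*) 1 E S"

definition chi :: "real ^ 'q \<Rightarrow> real ^ 'q \<Rightarrow> real" where
  "chi \<alpha> r = (\<Prod>i\<in>UNIV. (r $ i) powr (\<alpha> $ i))"

definition vartheta :: "real ^ 'q \<Rightarrow> (real ^ 'q) measure" where
  "vartheta \<alpha> = density (restrict_space lborel pos_orthant)
     (\<lambda>r. ennreal (\<Prod>i\<in>UNIV. \<alpha> $ i * (r $ i) powr (- (\<alpha> $ i) - 1)))"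

definition homogeneous_measure ::
  "'e measure \<Rightarrow> (real ^ 'q \<Rightarrow> 'e \<Rightarrow> 'e) \<Rightarrow> real ^ 'q \<Rightarrow> 'e measure \<Rightarrow> bool" where
  "homogeneous_measure E S \<alpha> \<nu> \<longleftrightarrow> sets \<nu> = sets E \<and>
     (\<forall>r\<in>pos_orthant. \<forall>A\<in>sets E.
        emeasure \<nu> (S r ` A) = ennreal (inverse (chi \<alpha> r)) * emeasure \<nu> A)"

definition sigma_finite_homogeneous_measures ::
  "'e measure \<Rightarrow> (real ^ 'q \<Rightarrow> 'e \<Rightarrow> 'e) \<Rightarrow> real ^ 'q \<Rightarrow> 'e measure set" where
  "sigma_finite_homogeneous_measures E S \<alpha> =
     {\<nu>. homogeneous_measure E S \<alpha> \<nu> \<and> sigma_finite_measure \<nu> \<and> emeasure \<nu> (space E) \<noteq> 0}"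

definition nu_of ::
  "'e measure \<Rightarrow> (real ^ 'q \<Rightarrow> 'e \<Rightarrow> 'e) \<Rightarrow> real ^ 'q \<Rightarrow> 'w measure \<Rightarrow> ('w \<Rightarrow> 'e) \<Rightarrow> 'e measure" where
  "nu_of E S \<alpha> P Z = measure_of (space E) (sets E)
     (\<lambda>A. \<integral>\<^sup>+ \<omega>. (\<integral>\<^sup>+ r. indicator A (S r (Z \<omega>)) \<partial>vartheta \<alpha>) \<partial>P)"

definition stochastic_representer ::
  "'e measure \<Rightarrow> (real ^ 'q \<Rightarrow> 'e \<Rightarrow> 'e) \<Rightarrow> real ^ 'q \<Rightarrow> 'w measure \<Rightarrow> ('w \<Rightarrow> 'e) \<Rightarrow> 'e measure \<Rightarrow> bool"
  where
  "stochastic_representer E S \<alpha> P Z \<nu> \<longleftrightarrow> Z \<in> measurable P E \<and> \<nu> = nu_of E S \<alpha> P Z"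

definition homogeneous_functions ::
  "'e measure \<Rightarrow> (real ^ 'q \<Rightarrow> 'e \<Rightarrow> 'e) \<Rightarrow> real ^ 'q \<Rightarrow> ('e \<Rightarrow> ennreal) set" where
  "homogeneous_functions E S \<alpha> =
     {\<Gamma> \<in> borel_measurable E.
        \<forall>r\<in>pos_orthant. \<forall>x\<in>space E. \<Gamma> (S r x) = ennreal (chi \<alpha> r) * \<Gamma> x}"

text \<open>
  The locally compact second-countable Hausdorff group \<open>T\<close> is the type \<open>'t\<close>; the library's class
  \<open>topological_group_add\<close> writes the operation additively but does not make it commutative.
\<close>

definition topological_group_action ::
  "'e measure \<Rightarrow>
     ('t :: {topological_group_add, t2_space, second_countable_topology} \<Rightarrow> 'e \<Rightarrow> 'e) \<Rightarrow> bool" where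
  "topological_group_action E B \<longleftrightarrow> measurable_action borel (+) 0 E B"

definition invariant_measure :: "'e measure \<Rightarrow> ('t \<Rightarrow> 'e \<Rightarrow> 'e) \<Rightarrow> 'e measure \<Rightarrow> bool" where
  "invariant_measure E B \<nu> \<longleftrightarrow> (\<forall>a. distr \<nu> E (B a) = \<nu>)"

end

theory Submission
  imports Defs
begin

text \<open>
  The push-forward of \<open>\<nu>\<^sub>Z\<close> under \<open>B\<^sup>a\<close> is \<open>\<nu>\<close> of \<open>B\<^sup>a Z\<close>, because \<open>B\<^sup>a\<close> commutes with the
  scaling; so invariance of \<open>\<nu>\<^sub>Z\<close> says exactly that each \<open>B\<^sup>a Z\<close> represents it.  What remains is
  to see that two random elements represent the same \<open>\<sigma>\<close>-finite measure exactly when they agree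
  in expectation on all homogeneous functions.

  One direction is an averaging argument: \<open>\<vartheta>\<^sub>\<alpha>\<close> is relatively invariant with multiplier
  \<open>\<chi>\<^sub>\<alpha>\<close>, so \<open>x \<mapsto> \<integral> g (S\<^sub>r x) \<vartheta>\<^sub>\<alpha>(dr)\<close> is homogeneous for every measurable \<open>g \<ge> 0\<close>, and for an
  indicator \<open>g = I\<^sub>A\<close> its expectation at \<open>Z\<close> is \<open>\<nu>\<^sub>Z(A)\<close>.

  For the other direction the expectation of a homogeneous \<open>\<Gamma>\<close> is recovered from \<open>\<nu>\<^sub>Z\<close> alone.
  By \<open>\<sigma>\<close>-finiteness some strictly positive \<open>g\<close> has a finite \<open>\<nu>\<^sub>Z\<close>-integral.  Its orbit average
  \<open>h\<close> is strictly positive, homogeneous, and finite at almost every value of \<open>Z\<close>.  Since \<open>\<Gamma>\<close> and \<open>h\<close>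
  scale alike, \<open>\<Gamma> / h\<close> is constant along such an orbit, so that averaging \<open>g \<Gamma> / h\<close> over the
  orbit of \<open>Z\<close> gives \<open>\<Gamma>(Z)\<close>, and \<open>E \<Gamma>(Z) = \<integral> g \<Gamma> / h d\<nu>\<^sub>Z\<close>.  The same \<open>g\<close> serves every
  representer of \<open>\<nu>\<^sub>Z\<close>.
\<close>

section \<open>The relatively invariant measure on the positive orthant\<close>

lemma open_pos_orthant: "open (pos_orthant :: (real ^ 'q) set)"
proof -
  have "(pos_orthant :: (real ^ 'q) set) = (\<Inter>i. {r. 0 < r $ i})"
    by (auto simp: pos_orthant_def)
  also have "open \<dots>"
    by (intro open_INT ballI open_Collect_less continuous_intros) simp
  finally show ?thesis .
qed

lemma sets_borel_pos_orthant [measurable]: "(pos_orthant :: (real ^ 'q) set) \<in> sets borel"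
  by (simp add: open_pos_orthant)

lemma one_mem_pos_orthant: "1 \<in> pos_orthant"
  by (simp add: pos_orthant_def)

lemma times_mem_pos_orthant: "r \<in> pos_orthant \<Longrightarrow> s \<in> pos_orthant \<Longrightarrow> r * s \<in> pos_orthant"
  by (simp add: pos_orthant_def)

lemma chi_pos: "r \<in> pos_orthant \<Longrightarrow> 0 < chi \<alpha> r"
  unfolding chi_def pos_orthant_def by (intro prod_pos) (simp add: less_imp_neq[THEN not_sym])

lemma sets_vartheta [measurable_cong]:
  "sets (vartheta \<alpha>) = sets (restrict_space borel pos_orthant)"
  unfolding vartheta_def by (simp cong: sets_restrict_space_cong)

lemma space_vartheta: "space (vartheta \<alpha>) = pos_orthant"
  by (simp add: vartheta_def space_restrict_space)

lemma measurable_vartheta_density [measurable]: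
  fixes \<alpha> :: "real ^ 'q"
  shows "(\<lambda>r :: real ^ 'q. ennreal (\<Prod>i\<in>UNIV. \<alpha> $ i * (r $ i) powr (- (\<alpha> $ i) - 1)))
    \<in> borel_measurable borel"
proof -
  have [measurable]: "(\<lambda>r :: real ^ 'q. r $ i) \<in> borel_measurable borel" for i
    by (intro borel_measurable_continuous_onI continuous_intros)
  show ?thesis by measurable
qed

lemma sigma_finite_vartheta:
  fixes \<alpha> :: "real ^ 'q"
  shows "sigma_finite_measure (vartheta \<alpha>)"
proof -
  interpret R: sigma_finite_measure "restrict_space lborel (pos_orthant :: (real ^ 'q) set)"
    by (intro sigma_finite_measure_restrict_space sigma_finite_lborel) simp
  show ?thesis
    unfolding vartheta_def
    by (subst R.sigma_finite_iff_density_finite)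
      (auto intro!: measurable_restrict_space1)
qed

lemma nn_integral_vartheta:
  fixes F :: "real ^ 'q \<Rightarrow> ennreal"
  assumes F: "F \<in> borel_measurable (restrict_space borel pos_orthant)"
  shows "(\<integral>\<^sup>+ r. F r \<partial>vartheta \<alpha>) =
    (\<integral>\<^sup>+ r. ennreal (\<Prod>i\<in>UNIV. \<alpha> $ i * (r $ i) powr (- (\<alpha> $ i) - 1)) * F r
      * indicator pos_orthant r \<partial>lborel)"
proof -
  have "F \<in> borel_measurable (restrict_space lborel pos_orthant)"
    using F by (simp cong: measurable_cong_sets add: sets_restrict_space)
  then have "(\<integral>\<^sup>+ r. F r \<partial>vartheta \<alpha>) =
    (\<integral>\<^sup>+ r. ennreal (\<Prod>i\<in>UNIV. \<alpha> $ i * (r $ i) powr (- (\<alpha> $ i) - 1)) * F r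
      \<partial>restrict_space lborel pos_orthant)"
    unfolding vartheta_def
    by (subst nn_integral_density) (auto intro!: measurable_restrict_space1)
  then show ?thesis
    by (simp add: nn_integral_restrict_space)
qed

lemma nn_integral_lborel_times:
  fixes s :: "real ^ 'q" and K :: "real ^ 'q \<Rightarrow> ennreal"
  assumes K: "K \<in> borel_measurable borel" and s: "s \<in> pos_orthant"
  shows "(\<integral>\<^sup>+ u. K u \<partial>lborel) = ennreal (\<Prod>i\<in>UNIV. s $ i) * (\<integral>\<^sup>+ r. K (r * s) \<partial>lborel)"
proof -
  have times: "(\<lambda>x. 0 + (\<Sum>j\<in>Basis. (s \<bullet> j * (x \<bullet> j)) *\<^sub>R j)) = (\<lambda>r. r * s)"
  proof
    fix x :: "real ^ 'q"
    have "(\<Sum>j\<in>Basis. (s \<bullet> j * (x \<bullet> j)) *\<^sub>R j) \<bullet> b = (x * s) \<bullet> b" if "b \<in> Basis" for b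
    proof -
      obtain i where "b = axis i 1" using \<open>b \<in> Basis\<close> by (auto simp: Basis_vec_def)
      then show ?thesis
        by (subst inner_sum_left_Basis[OF \<open>b \<in> Basis\<close>]) (simp add: inner_axis mult.commute)
    qed
    then show "0 + (\<Sum>j\<in>Basis. (s \<bullet> j * (x \<bullet> j)) *\<^sub>R j) = x * s"
      unfolding add_0_left by (rule euclidean_eqI)
  qed
  have nz: "s \<bullet> j \<noteq> 0" if "j \<in> Basis" for j
    using s that by (auto simp: Basis_vec_def inner_axis pos_orthant_def less_imp_neq[THEN not_sym])
  have jacobian: "(\<Prod>j\<in>(Basis :: (real ^ 'q) set). \<bar>s \<bullet> j\<bar>) = (\<Prod>i\<in>UNIV. s $ i)"
  proof -
    have Basis: "(Basis :: (real ^ 'q) set) = (\<lambda>i. axis i 1) ` UNIV"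
      by (auto simp: Basis_vec_def)
    have "inj (\<lambda>i. axis i (1::real) :: real ^ 'q)"
      by (auto simp: inj_on_def axis_eq_axis)
    then show ?thesis
      unfolding Basis using s
      by (subst prod.reindex) (auto simp: inner_axis pos_orthant_def less_imp_le intro!: prod.cong)
  qed
  have lborel: "lborel = density (distr lborel borel (\<lambda>r. r * s)) (\<lambda>_. ennreal (\<Prod>i\<in>UNIV. s $ i))"
    using lborel_affine_euclidean[of "\<lambda>j. s \<bullet> j" 0, OF nz] unfolding times jacobian .
  have [measurable]: "(\<lambda>r. r * s) \<in> borel_measurable borel"
    unfolding times[symmetric] by measurable
  have "(\<integral>\<^sup>+ u. K u \<partial>lborel) =
      (\<integral>\<^sup>+ u. ennreal (\<Prod>i\<in>UNIV. s $ i) * K u \<partial>distr lborel borel (\<lambda>r. r * s))"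
    using K by (subst lborel) (simp add: nn_integral_density)
  also have "\<dots> = ennreal (\<Prod>i\<in>UNIV. s $ i) * (\<integral>\<^sup>+ r. K (r * s) \<partial>lborel)"
    using K by (simp add: nn_integral_distr nn_integral_cmult)
  finally show ?thesis .
qed

text \<open>
  Substituting \<open>u = r s\<close> produces the Jacobian \<open>\<Prod>s\<^sub>i\<close>, while the density
  \<open>\<Prod>\<alpha>\<^sub>i r\<^sub>i\<^bsup>-\<alpha>\<^sub>i-1\<^esup>\<close> produces \<open>\<Prod>s\<^sub>i\<^bsup>-\<alpha>\<^sub>i-1\<^esup>\<close>; what is left over is \<open>\<chi>\<^sub>\<alpha>(s)\<^sup>-\<^sup>1\<close>.
\<close>

lemma nn_integral_vartheta_times:
  fixes F :: "real ^ 'q \<Rightarrow> ennreal"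
  assumes F: "F \<in> borel_measurable (restrict_space borel pos_orthant)"
    and s: "s \<in> pos_orthant" and \<alpha>: "\<alpha> \<in> pos_orthant"
  shows "(\<integral>\<^sup>+ r. F (r * s) \<partial>vartheta \<alpha>) = ennreal (chi \<alpha> s) * (\<integral>\<^sup>+ u. F u \<partial>vartheta \<alpha>)"
proof -
  define d where "d r = (\<Prod>i\<in>UNIV. \<alpha> $ i * (r $ i) powr (- (\<alpha> $ i) - 1))" for r :: "real ^ 'q"
  define c where "c = (\<Prod>i\<in>UNIV. (s $ i) powr (- (\<alpha> $ i) - 1))"
  define K where "K u = ennreal (d u) * F u * indicator pos_orthant u" for u
  have s_pos: "0 < s $ i" for i using s by (simp add: pos_orthant_def)
  have c_nonneg: "0 \<le> c" unfolding c_def by (intro prod_nonneg) simp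
  have d_nonneg: "0 \<le> d r" for r
    unfolding d_def using \<alpha> by (intro prod_nonneg) (simp add: pos_orthant_def less_imp_le)
  have [measurable]: "(\<lambda>r. ennreal (d r)) \<in> borel_measurable borel"
    unfolding d_def by (rule measurable_vartheta_density)
  have "(\<lambda>u. F u * indicator pos_orthant u) \<in> borel_measurable borel"
    using F by (subst (asm) borel_measurable_restrict_space_iff_ennreal) auto
  then have K_meas: "K \<in> borel_measurable borel"
    unfolding K_def mult.assoc by measurable
  have times_meas: "(\<lambda>r. r * s) \<in> measurable (restrict_space borel pos_orthant) (restrict_space borel pos_orthant)"
  proof (rule measurable_restrict_space3)
    have "continuous_on UNIV (\<lambda>r :: real ^ 'q. \<chi> i. r $ i * s $ i)"
      by (intro continuous_intros)
    then show "(\<lambda>r. r * s) \<in> borel_measurable borel"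
      by (intro borel_measurable_continuous_onI) (simp add: times_vec_def)
  qed (use s in \<open>auto intro: times_mem_pos_orthant\<close>)
  have chi_cancel: "chi \<alpha> s * (\<Prod>i\<in>UNIV. s $ i) * c = 1"
  proof -
    have "chi \<alpha> s * (\<Prod>i\<in>UNIV. s $ i) * c =
        (\<Prod>i\<in>UNIV. (s $ i) powr (\<alpha> $ i) * (s $ i) * (s $ i) powr (- (\<alpha> $ i) - 1))"
      by (simp add: chi_def c_def prod.distrib)
    also have "\<dots> = 1"
    proof (intro prod.neutral ballI)
      fix i
      have "(s $ i) powr (\<alpha> $ i) * (s $ i) powr 1 * (s $ i) powr (- (\<alpha> $ i) - 1) = 1"
        unfolding powr_add[symmetric] using s_pos[of i] by simp
      then show "(s $ i) powr (\<alpha> $ i) * (s $ i) * (s $ i) powr (- (\<alpha> $ i) - 1) = 1"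
        using s_pos[of i] by simp
    qed
    finally show ?thesis .
  qed
  have K_times: "K (r * s) = ennreal c * (ennreal (d r) * F (r * s) * indicator pos_orthant r)" for r
  proof (cases "r \<in> pos_orthant")
    case True
    then have "d (r * s) = c * d r"
      unfolding d_def c_def prod.distrib[symmetric] using s_pos
      by (intro prod.cong) (simp_all add: pos_orthant_def powr_mult less_imp_le)
    then show ?thesis
      using True times_mem_pos_orthant[OF True s] c_nonneg d_nonneg
      by (simp add: K_def ennreal_mult mult.assoc)
  next
    case False
    then have "r * s \<notin> pos_orthant"
      using s_pos by (auto simp: pos_orthant_def zero_less_mult_iff dest: less_asym)
    with False show ?thesis by (simp add: K_def)
  qed
  have Fs: "(\<lambda>r. F (r * s)) \<in> borel_measurable (restrict_space borel pos_orthant)"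
    using measurable_compose[OF times_meas F] .
  define L where "L = (\<integral>\<^sup>+ r. F (r * s) \<partial>vartheta \<alpha>)"
  have L: "L = (\<integral>\<^sup>+ r. ennreal (d r) * F (r * s) * indicator pos_orthant r \<partial>lborel)"
    unfolding L_def d_def by (rule nn_integral_vartheta[OF Fs])
  have G_meas: "(\<lambda>r. ennreal (d r) * F (r * s) * indicator pos_orthant r) \<in> borel_measurable borel"
  proof -
    have "(\<lambda>r. F (r * s) * indicator pos_orthant r) \<in> borel_measurable borel"
      using Fs by (subst (asm) borel_measurable_restrict_space_iff_ennreal) auto
    then show ?thesis unfolding mult.assoc by measurable
  qed
  have "(\<integral>\<^sup>+ u. F u \<partial>vartheta \<alpha>) = (\<integral>\<^sup>+ u. K u \<partial>lborel)"
    unfolding K_def d_def by (rule nn_integral_vartheta[OF F])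
  also have "\<dots> = ennreal (\<Prod>i\<in>UNIV. s $ i) * (ennreal c * L)"
    unfolding nn_integral_lborel_times[OF K_meas s] K_times L
    using G_meas by (subst nn_integral_cmult) auto
  finally have "ennreal (chi \<alpha> s) * (\<integral>\<^sup>+ u. F u \<partial>vartheta \<alpha>) =
      ennreal (chi \<alpha> s) * ennreal (\<Prod>i\<in>UNIV. s $ i) * ennreal c * L"
    by (simp add: mult.assoc)
  also have "ennreal (chi \<alpha> s) * ennreal (\<Prod>i\<in>UNIV. s $ i) * ennreal c = 1"
    using chi_cancel chi_pos[OF s, of \<alpha>] c_nonneg s_pos
    by (simp add: ennreal_mult[symmetric] prod_nonneg less_imp_le)
  finally show ?thesis by (simp add: L_def)
qed

text \<open>
  The orthant is open and nonempty, hence not a null set, and the density of \<open>\<vartheta>\<^sub>\<alpha>\<close> vanishes nowhere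
  on it.
\<close>

lemma nn_integral_vartheta_pos:
  fixes F :: "real ^ 'q \<Rightarrow> ennreal"
  assumes F: "F \<in> borel_measurable (restrict_space borel pos_orthant)"
    and pos: "\<And>r. r \<in> pos_orthant \<Longrightarrow> 0 < F r" and \<alpha>: "\<alpha> \<in> pos_orthant"
  shows "(\<integral>\<^sup>+ r. F r \<partial>vartheta \<alpha>) \<noteq> 0"
proof
  define d where "d r = (\<Prod>i\<in>UNIV. \<alpha> $ i * (r $ i) powr (- (\<alpha> $ i) - 1))" for r :: "real ^ 'q"
  define k where "k r = ennreal (d r) * F r * indicator pos_orthant r" for r
  have [measurable]: "(\<lambda>r. ennreal (d r)) \<in> borel_measurable borel"
    unfolding d_def by (rule measurable_vartheta_density)
  assume "(\<integral>\<^sup>+ r. F r \<partial>vartheta \<alpha>) = 0"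
  then have "(\<integral>\<^sup>+ r. k r \<partial>lborel) = 0"
    by (simp add: nn_integral_vartheta[OF F] k_def d_def)
  moreover have "(\<lambda>r. F r * indicator pos_orthant r) \<in> borel_measurable borel"
    using F by (subst (asm) borel_measurable_restrict_space_iff_ennreal) auto
  then have "k \<in> borel_measurable borel"
    unfolding k_def mult.assoc by measurable
  ultimately have "AE r in lborel. k r = 0"
    by (simp add: nn_integral_0_iff_AE)
  moreover have "k r \<noteq> 0" if "r \<in> pos_orthant" for r
  proof -
    have "0 < d r"
      unfolding d_def using that \<alpha> by (intro prod_pos) (simp add: pos_orthant_def less_imp_neq[THEN not_sym])
    with pos[OF that] show ?thesis
      using that by (simp add: k_def)
  qed
  ultimately have "AE r in lborel. r \<notin> (pos_orthant :: (real ^ 'q) set)"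
    by (auto elim: eventually_mono)
  then have "(pos_orthant :: (real ^ 'q) set) \<in> null_sets lborel"
    by (subst AE_iff_null_sets) auto
  then have "negligible (pos_orthant :: (real ^ 'q) set)"
    by (simp add: negligible_iff_null_sets null_sets_completionI)
  with open_pos_orthant one_mem_pos_orthant show False
    using open_not_negligible by blast
qed

section \<open>Orbit averages\<close>

definition orbit_average ::
  "(real ^ 'q \<Rightarrow> 'e \<Rightarrow> 'e) \<Rightarrow> real ^ 'q \<Rightarrow> ('e \<Rightarrow> ennreal) \<Rightarrow> 'e \<Rightarrow> ennreal" where
  "orbit_average S \<alpha> g x = (\<integral>\<^sup>+ r. g (S r x) \<partial>vartheta \<alpha>)"

lemma scaling_action_measurable_pair:
  "scaling_action E S \<Longrightarrow> (\<lambda>(r, x). S r x) \<in> measurable (vartheta \<alpha> \<Otimes>\<^sub>M E) E"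
  unfolding scaling_action_def measurable_action_def
  by (simp cong: measurable_cong_sets sets_pair_measure_cong add: sets_vartheta)

lemma scaling_action_measurable_orbit:
  assumes S: "scaling_action E S" and x: "x \<in> space E"
  shows "(\<lambda>r. S r x) \<in> measurable (restrict_space borel pos_orthant) E"
proof -
  have "(\<lambda>(r, x). S r x) \<in> measurable (restrict_space borel pos_orthant \<Otimes>\<^sub>M E) E"
    using S by (simp add: scaling_action_def measurable_action_def)
  from measurable_Pair2'[OF x, THEN measurable_compose, OF this] show ?thesis by simp
qed

lemma scaling_action_space:
  "scaling_action E S \<Longrightarrow> x \<in> space E \<Longrightarrow> r \<in> pos_orthant \<Longrightarrow> S r x \<in> space E"
  using measurable_space[OF scaling_action_measurable_orbit, of E S x r]
  by (simp add: space_restrict_space)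

lemma scaling_action_times:
  "scaling_action E S \<Longrightarrow> x \<in> space E \<Longrightarrow> r \<in> pos_orthant \<Longrightarrow> s \<in> pos_orthant \<Longrightarrow>
    S r (S s x) = S (r * s) x"
  by (simp add: scaling_action_def measurable_action_def space_restrict_space)

lemma orbit_average_measurable:
  assumes S: "scaling_action E S" and g: "g \<in> borel_measurable E"
  shows "orbit_average S \<alpha> g \<in> borel_measurable E"
proof -
  interpret sigma_finite_measure "vartheta \<alpha>" by (rule sigma_finite_vartheta)
  have "(\<lambda>(x, r). g (S r x)) \<in> borel_measurable (E \<Otimes>\<^sub>M vartheta \<alpha>)"
    using measurable_compose[OF measurable_compose[OF measurable_pair_swap'
        scaling_action_measurable_pair[OF S]] g]
    by (simp add: case_prod_beta)
  from borel_measurable_nn_integral[OF this] show ?thesis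
    unfolding orbit_average_def .
qed

lemma orbit_average_homogeneous:
  assumes S: "scaling_action E S" and g: "g \<in> borel_measurable E" and \<alpha>: "\<alpha> \<in> pos_orthant"
  shows "orbit_average S \<alpha> g \<in> homogeneous_functions E S \<alpha>"
proof -
  have "orbit_average S \<alpha> g (S s x) = ennreal (chi \<alpha> s) * orbit_average S \<alpha> g x"
    if s: "s \<in> pos_orthant" and x: "x \<in> space E" for s x
  proof -
    have "orbit_average S \<alpha> g (S s x) = (\<integral>\<^sup>+ r. g (S (r * s) x) \<partial>vartheta \<alpha>)"
      unfolding orbit_average_def
      by (intro nn_integral_cong) (simp add: space_vartheta scaling_action_times[OF S x _ s])
    also have "\<dots> = ennreal (chi \<alpha> s) * orbit_average S \<alpha> g x"
      unfolding orbit_average_def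
      by (rule nn_integral_vartheta_times[OF _ s \<alpha>])
        (rule measurable_compose[OF scaling_action_measurable_orbit[OF S x] g])
    finally show ?thesis .
  qed
  then show ?thesis
    using orbit_average_measurable[OF S g] by (simp add: homogeneous_functions_def)
qed

text \<open>
  The function \<open>\<Gamma> / h\<close> is constant along the orbit of \<open>x\<close>, with value \<open>\<Gamma>(x) / h(x)\<close>; it can be
  taken out of the average of \<open>g\<close>, which is \<open>h(x)\<close>.  This needs \<open>h(x)\<close> to be neither \<open>0\<close> nor
  \<open>\<infinity>\<close>; positivity of \<open>g\<close> excludes the former.
\<close>

lemma orbit_average_normalized:
  fixes g :: "'e \<Rightarrow> ennreal"
  assumes S: "scaling_action E S" and g: "g \<in> borel_measurable E" and \<alpha>: "\<alpha> \<in> pos_orthant"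
    and pos: "\<And>x. x \<in> space E \<Longrightarrow> 0 < g x"
    and \<Gamma>: "\<Gamma> \<in> homogeneous_functions E S \<alpha>"
    and x: "x \<in> space E" and fin: "orbit_average S \<alpha> g x \<noteq> \<infinity>"
  shows "orbit_average S \<alpha> (\<lambda>y. g y * (\<Gamma> y / orbit_average S \<alpha> g y)) x = \<Gamma> x"
proof -
  define h where "h = orbit_average S \<alpha> g"
  have gx: "(\<lambda>r. g (S r x)) \<in> borel_measurable (restrict_space borel pos_orthant)"
    by (rule measurable_compose[OF scaling_action_measurable_orbit[OF S x] g])
  have h: "h (S r x) = ennreal (chi \<alpha> r) * h x" if "r \<in> pos_orthant" for r
    using orbit_average_homogeneous[OF S g \<alpha>] that x by (simp add: h_def homogeneous_functions_def)
  have h_fin: "h x \<noteq> top" using fin by (simp add: h_def)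
  have h_nz: "h x \<noteq> 0"
    unfolding h_def orbit_average_def
    using scaling_action_space[OF S x] by (intro nn_integral_vartheta_pos[OF gx _ \<alpha>] pos)
  have quot: "\<Gamma> (S r x) / h (S r x) = \<Gamma> x / h x" if r: "r \<in> pos_orthant" for r
  proof -
    have "\<Gamma> (S r x) = ennreal (chi \<alpha> r) * \<Gamma> x"
      using \<Gamma> r x by (simp add: homogeneous_functions_def)
    then show ?thesis
      unfolding h[OF r] using chi_pos[OF r, of \<alpha>] divide_mult_eq[of "ennreal (chi \<alpha> r)" "\<Gamma> x" "h x"]
      by (simp add: mult.commute)
  qed
  have "orbit_average S \<alpha> (\<lambda>y. g y * (\<Gamma> y / h y)) x = (\<integral>\<^sup>+ r. g (S r x) * (\<Gamma> x / h x) \<partial>vartheta \<alpha>)"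
    unfolding orbit_average_def by (intro nn_integral_cong) (simp add: space_vartheta quot)
  also have "\<dots> = h x * (\<Gamma> x / h x)"
    unfolding h_def orbit_average_def using gx
    by (subst nn_integral_multc) (simp_all cong: measurable_cong_sets add: sets_vartheta)
  also have "\<dots> = \<Gamma> x"
    using h_nz h_fin by (simp add: ennreal_times_divide mult_divide_eq_ennreal mult.commute[of "h x"])
  finally show ?thesis by (simp add: h_def)
qed

section \<open>Represented measures\<close>

text \<open>
  Writing \<open>\<nu>\<^sub>Z\<close> as the law of \<open>S\<^sub>r Z\<close> under \<open>P \<otimes> \<vartheta>\<^sub>\<alpha>\<close> shows at once that its defining set function is
  countably additive, so that the values of \<open>nu_of\<close> and integrals against it are the expected ones.
\<close>

lemma nu_of_eq_distr:
  assumes S: "scaling_action E S" and Z: "Z \<in> measurable P E"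
  shows "nu_of E S \<alpha> P Z = distr (P \<Otimes>\<^sub>M vartheta \<alpha>) E (\<lambda>(\<omega>, r). S r (Z \<omega>))" (is "_ = ?D")
    and "(\<lambda>(\<omega>, r). S r (Z \<omega>)) \<in> measurable (P \<Otimes>\<^sub>M vartheta \<alpha>) E"
proof -
  interpret sigma_finite_measure "vartheta \<alpha>" by (rule sigma_finite_vartheta)
  have "(\<lambda>(\<omega>, r). (r, Z \<omega>)) \<in> measurable (P \<Otimes>\<^sub>M vartheta \<alpha>) (vartheta \<alpha> \<Otimes>\<^sub>M E)"
    using Z by measurable
  from measurable_compose[OF this scaling_action_measurable_pair[OF S]]
  show meas: "(\<lambda>(\<omega>, r). S r (Z \<omega>)) \<in> measurable (P \<Otimes>\<^sub>M vartheta \<alpha>) E"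
    by (simp add: case_prod_beta)
  have "emeasure ?D A = (\<integral>\<^sup>+ \<omega>. (\<integral>\<^sup>+ r. indicator A (S r (Z \<omega>)) \<partial>vartheta \<alpha>) \<partial>P)"
    if A: "A \<in> sets E" for A
  proof -
    have "emeasure ?D A = (\<integral>\<^sup>+ p. indicator A (case p of (\<omega>, r) \<Rightarrow> S r (Z \<omega>)) \<partial>(P \<Otimes>\<^sub>M vartheta \<alpha>))"
      using A by (simp add: nn_integral_distr[OF meas] flip: nn_integral_indicator)
    also have "\<dots> = (\<integral>\<^sup>+ \<omega>. (\<integral>\<^sup>+ r. indicator A (S r (Z \<omega>)) \<partial>vartheta \<alpha>) \<partial>P)"
      using A by (subst nn_integral_fst[symmetric]) (auto intro!: measurable_compose[OF meas])
    finally show ?thesis .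
  qed
  then have "nu_of E S \<alpha> P Z = measure_of (space ?D) (sets ?D) (emeasure ?D)"
    unfolding nu_of_def
    by (simp, intro measure_of_eq) (auto simp: sets.space_closed sets.sigma_sets_eq)
  also have "\<dots> = ?D" by (rule measure_of_of_measure)
  finally show "nu_of E S \<alpha> P Z = ?D" .
qed

lemma sets_nu_of: "sets (nu_of E S \<alpha> P Z) = sets E"
  by (simp add: nu_of_def sets.space_closed sets.sigma_sets_eq)

lemma nn_integral_nu_of:
  assumes S: "scaling_action E S" and Z: "Z \<in> measurable P E" and f: "f \<in> borel_measurable E"
  shows "(\<integral>\<^sup>+ x. f x \<partial>nu_of E S \<alpha> P Z) = (\<integral>\<^sup>+ \<omega>. orbit_average S \<alpha> f (Z \<omega>) \<partial>P)"
proof -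
  interpret sigma_finite_measure "vartheta \<alpha>" by (rule sigma_finite_vartheta)
  note meas = nu_of_eq_distr(2)[OF S Z]
  have "(\<integral>\<^sup>+ x. f x \<partial>nu_of E S \<alpha> P Z) =
      (\<integral>\<^sup>+ p. f (case p of (\<omega>, r) \<Rightarrow> S r (Z \<omega>)) \<partial>(P \<Otimes>\<^sub>M vartheta \<alpha>))"
    unfolding nu_of_eq_distr(1)[OF S Z] using meas f by (subst nn_integral_distr) auto
  also have "\<dots> = (\<integral>\<^sup>+ \<omega>. orbit_average S \<alpha> f (Z \<omega>) \<partial>P)"
    unfolding orbit_average_def
    by (subst nn_integral_fst[symmetric]) (auto intro!: measurable_compose[OF meas f])
  finally show ?thesis .
qed

lemma emeasure_nu_of:
  assumes "scaling_action E S" and "Z \<in> measurable P E" and "A \<in> sets E"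
  shows "emeasure (nu_of E S \<alpha> P Z) A = (\<integral>\<^sup>+ \<omega>. orbit_average S \<alpha> (indicator A) (Z \<omega>) \<partial>P)"
  using nn_integral_nu_of[OF assms(1,2) borel_measurable_indicator[OF assms(3)]] assms(3)
  by (simp add: sets_nu_of)

text \<open>
  The orbit averages of indicators are themselves homogeneous functions, and their expectations are the
  values of the represented measure.
\<close>

lemma nu_of_eq_if_homogeneous_expectations_eq:
  assumes S: "scaling_action E S" and \<alpha>: "\<alpha> \<in> pos_orthant"
    and Z: "Z \<in> measurable P E" and Z': "Z' \<in> measurable P' E"
    and eq: "\<And>\<Gamma>. \<Gamma> \<in> homogeneous_functions E S \<alpha> \<Longrightarrow>
      (\<integral>\<^sup>+ \<omega>. \<Gamma> (Z' \<omega>) \<partial>P') = (\<integral>\<^sup>+ \<omega>. \<Gamma> (Z \<omega>) \<partial>P)"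
  shows "nu_of E S \<alpha> P' Z' = nu_of E S \<alpha> P Z"
proof (rule measure_eqI)
  fix A assume "A \<in> sets (nu_of E S \<alpha> P' Z')"
  then have A: "A \<in> sets E" by (simp add: sets_nu_of)
  then show "emeasure (nu_of E S \<alpha> P' Z') A = emeasure (nu_of E S \<alpha> P Z) A"
    unfolding emeasure_nu_of[OF S Z A] emeasure_nu_of[OF S Z' A]
    by (intro eq orbit_average_homogeneous[OF S _ \<alpha>]) simp
qed (simp add: sets_nu_of)

text \<open>
  Because \<open>g\<close> has a finite integral, its orbit average is finite at almost every value of \<open>Z\<close>, and
  at those values the normalization along orbits applies.  The left-hand side depends on \<open>P\<close> and \<open>Z\<close>
  only through \<open>\<nu>\<^sub>Z\<close>; this is what makes the expectation of \<open>\<Gamma>\<close> the same for all representers.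
\<close>

lemma nn_integral_nu_of_normalized:
  fixes g :: "'e \<Rightarrow> ennreal"
  assumes S: "scaling_action E S" and \<alpha>: "\<alpha> \<in> pos_orthant" and Z: "Z \<in> measurable P E"
    and g: "g \<in> borel_measurable E" and pos: "\<And>x. x \<in> space E \<Longrightarrow> 0 < g x"
    and fin: "(\<integral>\<^sup>+ x. g x \<partial>nu_of E S \<alpha> P Z) \<noteq> \<infinity>"
    and \<Gamma>: "\<Gamma> \<in> homogeneous_functions E S \<alpha>"
  shows "(\<integral>\<^sup>+ x. g x * (\<Gamma> x / orbit_average S \<alpha> g x) \<partial>nu_of E S \<alpha> P Z) = (\<integral>\<^sup>+ \<omega>. \<Gamma> (Z \<omega>) \<partial>P)"
proof -
  note h_meas [measurable] = orbit_average_measurable[OF S g, of \<alpha>]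
  have \<Gamma>_meas [measurable]: "\<Gamma> \<in> borel_measurable E"
    using \<Gamma> by (simp add: homogeneous_functions_def)
  have "AE \<omega> in P. orbit_average S \<alpha> g (Z \<omega>) \<noteq> \<infinity>"
    using fin unfolding nn_integral_nu_of[OF S Z g]
    by (intro nn_integral_noteq_infinite measurable_compose[OF Z h_meas])
  with AE_space have "AE \<omega> in P.
      orbit_average S \<alpha> (\<lambda>y. g y * (\<Gamma> y / orbit_average S \<alpha> g y)) (Z \<omega>) = \<Gamma> (Z \<omega>)"
  proof eventually_elim
    case (elim \<omega>)
    then show ?case
      by (intro orbit_average_normalized[OF S g \<alpha> pos \<Gamma>] measurable_space[OF Z])
  qed
  then have "(\<integral>\<^sup>+ \<omega>. orbit_average S \<alpha> (\<lambda>y. g y * (\<Gamma> y / orbit_average S \<alpha> g y)) (Z \<omega>) \<partial>P) =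
      (\<integral>\<^sup>+ \<omega>. \<Gamma> (Z \<omega>) \<partial>P)"
    by (rule nn_integral_cong_AE)
  moreover have "(\<lambda>y. g y * (\<Gamma> y / orbit_average S \<alpha> g y)) \<in> borel_measurable E"
    using g by measurable
  ultimately show ?thesis by (simp add: nn_integral_nu_of[OF S Z])
qed

lemma homogeneous_expectations_eq_if_nu_of_eq:
  assumes S: "scaling_action E S" and \<alpha>: "\<alpha> \<in> pos_orthant"
    and Z: "Z \<in> measurable P E" and Z': "Z' \<in> measurable P' E"
    and sf: "sigma_finite_measure (nu_of E S \<alpha> P Z)"
    and eq: "nu_of E S \<alpha> P' Z' = nu_of E S \<alpha> P Z"
    and \<Gamma>: "\<Gamma> \<in> homogeneous_functions E S \<alpha>"
  shows "(\<integral>\<^sup>+ \<omega>. \<Gamma> (Z' \<omega>) \<partial>P') = (\<integral>\<^sup>+ \<omega>. \<Gamma> (Z \<omega>) \<partial>P)"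
proof -
  note nu_sets = sets_nu_of[of E S \<alpha> P Z]
  obtain g where g: "g \<in> borel_measurable E" and fin: "(\<integral>\<^sup>+ x. g x \<partial>nu_of E S \<alpha> P Z) \<noteq> \<infinity>"
    and pos: "\<And>x. x \<in> space E \<Longrightarrow> 0 < g x"
    using sigma_finite_measure.Ex_finite_integrable_function[OF sf]
    by (auto simp: sets_eq_imp_space_eq[OF nu_sets] cong: measurable_cong_sets simp: nu_sets)
  have fin': "(\<integral>\<^sup>+ x. g x \<partial>nu_of E S \<alpha> P' Z') \<noteq> \<infinity>"
    using fin by (simp add: eq)
  show ?thesis
    using nn_integral_nu_of_normalized[OF S \<alpha> Z g pos fin \<Gamma>]
      nn_integral_nu_of_normalized[OF S \<alpha> Z' g pos fin' \<Gamma>]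
    by (simp add: eq)
qed

lemma distr_nu_of:
  assumes S: "scaling_action E S" and Z: "Z \<in> measurable P E" and T: "T \<in> measurable E E"
    and commute: "\<And>r x. r \<in> pos_orthant \<Longrightarrow> x \<in> space E \<Longrightarrow> T (S r x) = S r (T x)"
  shows "distr (nu_of E S \<alpha> P Z) E T = nu_of E S \<alpha> P (\<lambda>\<omega>. T (Z \<omega>))"
proof -
  have "distr (nu_of E S \<alpha> P Z) E T =
      distr (P \<Otimes>\<^sub>M vartheta \<alpha>) E (T \<circ> (\<lambda>(\<omega>, r). S r (Z \<omega>)))"
    unfolding nu_of_eq_distr(1)[OF S Z] by (rule distr_distr[OF T nu_of_eq_distr(2)[OF S Z]])
  also have "\<dots> = distr (P \<Otimes>\<^sub>M vartheta \<alpha>) E (\<lambda>(\<omega>, r). S r (T (Z \<omega>)))"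
    using measurable_space[OF Z]
    by (intro distr_cong) (auto simp: space_pair_measure space_vartheta commute)
  also have "\<dots> = nu_of E S \<alpha> P (\<lambda>\<omega>. T (Z \<omega>))"
    by (rule nu_of_eq_distr(1)[OF S measurable_compose[OF Z T], symmetric])
  finally show ?thesis .
qed

lemma topological_group_action_measurable:
  assumes "topological_group_action E B"
  shows "B a \<in> measurable E E"
proof -
  have "(\<lambda>(a, x). B a x) \<in> measurable (borel \<Otimes>\<^sub>M E) E"
    using assms by (simp add: topological_group_action_def measurable_action_def)
  from measurable_compose[OF measurable_Pair1' this, of a] show ?thesis by simp
qed

section \<open>Invariance of a represented measure\<close>

theorem corollary2p6:
  fixes E :: "'e measure"
    and S :: "real ^ 'q \<Rightarrow> 'e \<Rightarrow> 'e"
    and \<alpha> :: "real ^ 'q"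
    and B :: "'t :: {topological_group_add, t2_space, second_countable_topology} \<Rightarrow> 'e \<Rightarrow> 'e"
    and P :: "'w measure"
    and Z :: "'w \<Rightarrow> 'e"
    and \<nu> :: "'e measure"
  assumes "\<alpha> \<in> pos_orthant"
    and "scaling_action E S"
    and "locally_compact_space (euclidean :: 't topology)"
    and "topological_group_action E B"
    and "\<And>a r x. r \<in> pos_orthant \<Longrightarrow> x \<in> space E \<Longrightarrow> B a (S r x) = S r (B a x)"
    and "prob_space P"
    and "Z \<in> measurable P E"
    and "\<nu> = nu_of E S \<alpha> P Z"
    and "\<nu> \<in> sigma_finite_homogeneous_measures E S \<alpha>"
  shows "(invariant_measure E B \<nu> \<longleftrightarrow> (\<forall>a. nu_of E S \<alpha> P (\<lambda>\<omega>. B a (Z \<omega>)) = nu_of E S \<alpha> P Z)) \<and>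
    ((\<forall>a. nu_of E S \<alpha> P (\<lambda>\<omega>. B a (Z \<omega>)) = nu_of E S \<alpha> P Z) \<longleftrightarrow>
      (\<forall>a. stochastic_representer E S \<alpha> P (\<lambda>\<omega>. B a (Z \<omega>)) \<nu>)) \<and>
    (invariant_measure E B \<nu> \<longleftrightarrow>
      (\<forall>a. \<forall>\<Gamma>\<in>homogeneous_functions E S \<alpha>.
        (\<integral>\<^sup>+ \<omega>. \<Gamma> (B a (Z \<omega>)) \<partial>P) = (\<integral>\<^sup>+ \<omega>. \<Gamma> (Z \<omega>) \<partial>P)))"
proof -
  note S = assms(2) and \<alpha> = assms(1) and Z = assms(7)
  have BZ: "(\<lambda>\<omega>. B a (Z \<omega>)) \<in> measurable P E" for a
    by (rule measurable_compose[OF Z topological_group_action_measurable[OF assms(4)]])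
  have distr: "distr \<nu> E (B a) = nu_of E S \<alpha> P (\<lambda>\<omega>. B a (Z \<omega>))" for a
    unfolding assms(8)
    using S Z topological_group_action_measurable[OF assms(4)] assms(5)[where a = a]
    by (rule distr_nu_of[where T = "B a"])
  have sf: "sigma_finite_measure (nu_of E S \<alpha> P Z)"
    using assms(8,9) by (simp add: sigma_finite_homogeneous_measures_def)
  have invariant: "invariant_measure E B \<nu> \<longleftrightarrow> (\<forall>a. nu_of E S \<alpha> P (\<lambda>\<omega>. B a (Z \<omega>)) = nu_of E S \<alpha> P Z)"
    unfolding invariant_measure_def distr unfolding assms(8) ..
  have representers: "(\<forall>a. nu_of E S \<alpha> P (\<lambda>\<omega>. B a (Z \<omega>)) = nu_of E S \<alpha> P Z) \<longleftrightarrow>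
      (\<forall>a. stochastic_representer E S \<alpha> P (\<lambda>\<omega>. B a (Z \<omega>)) \<nu>)"
    unfolding stochastic_representer_def assms(8) using BZ by metis
  have expectations: "nu_of E S \<alpha> P (\<lambda>\<omega>. B a (Z \<omega>)) = nu_of E S \<alpha> P Z \<longleftrightarrow>
      (\<forall>\<Gamma>\<in>homogeneous_functions E S \<alpha>.
        (\<integral>\<^sup>+ \<omega>. \<Gamma> (B a (Z \<omega>)) \<partial>P) = (\<integral>\<^sup>+ \<omega>. \<Gamma> (Z \<omega>) \<partial>P))" for a
    using homogeneous_expectations_eq_if_nu_of_eq[OF S \<alpha> Z BZ sf]
      nu_of_eq_if_homogeneous_expectations_eq[OF S \<alpha> Z BZ] by blast
  show ?thesis
    by (intro conjI representers invariant) (simp only: invariant expectations)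
qed

end
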